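(* Let $\hat D$ be a co-loopless Le-diagram of type $(k,n)$ with decorated permutation $\hat\pi$, and let $D$ be the filling produced from $\hat D$ by the algorithm described in the context. Then $D$ is a loopless Le-diagram of type $(k+1,n)$ such that (1) the number of $+$'s in $D$ equals the number of $+$'s in $\hat D$ minus $2k$ plus $n-1$, i.e. $\dim(S_D)=\dim(S_{\hat D})-2k+(n-1)$; and (2) the decorated permutation of $D$ is the T-dual $\pi$ of $\hat\pi$, namely $\pi(i)=\hat\pi(i+1)$ for $1\le i\le n-1$, $\pi(n)=\hat\pi(1)$, with all fixed points of $\pi$ being co-loops.
   Context: Le-diagrams. For $0\le k\le n$, a Le-diagram of type $(k,n)$ is a filling of a Young diagram $\lambda$ (English convention, placed in the top-left corner of a $k\times(n-k)$ rectangle and fitting inside it) with symbols $0$ and $+$ such that no box containing $0$ has both a $+$ somewhere above it in its column and a $+$ somewhere to its left in its row. The south-east boundary of $\lambda$ is a lattice path of $n$ unit steps from the top-right to the bottom-left corner of the rectangle; label its steps $1,\dots,n$ in order. Labels of vertical steps are row labels (each of the $k$ rows, possibly of length $0$, gets the label of the vertical step at its right end); labels of horizontal steps are column labels (each of the $n-k$ columns, possibly of length $0$, gets the label of the step at its bottom). Box $(i,j)$ is the box in row $i$ and column $j$ (if it lies in $\lambda$; then $i<j$). "Below" means larger row label, "to the left" means larger column label. Decorated permutation $\pi_D$: replace each $0$ by a crossing of two pipes and each $+$ by an elbow (a pipe entering from the bottom exits to the left, a pipe entering from the right exits at the top); label the north-west boundary so that each row's left end carries the row label and each column's top end carries the column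 label. The pipe starting at boundary step $i$ (moving left if $i$ is a row label, up if $i$ is a column label) exits at north-west label $j$; set $\pi_D(i)=j$. A fixed point $i$ is a co-loop if $i$ is a row label and a loop if $i$ is a column label. The row labels are exactly the anti-excedances. $D$ is loopless if $\pi_D$ has no loops (equivalently every column contains a $+$) and co-loopless if $\pi_D$ has no co-loops (equivalently every row is nonempty and contains a $+$). The positroid cell $S_D$ indexed by $D$ has dimension equal to the number of $+$'s in $D$. The algorithm. Let $\hat D$ be co-loopless of type $(k,n)$ with row labels $b_1<\dots<b_k$, and let $a_n=\hat\pi(1)$ (a column label of $\hat D$). $D$ has the Young-diagram shape of type $(k+1,n)$ whose row labels are $\{b_1,\dots,b_k,a_n\}$ (all other labels being column labels). For a row $b_u$ of $\hat D$ let $L_u$ be the column label of the leftmost $+$ in row $b_u$ of $\hat D$; for row $a_n$ set $L=\infty$ and regard the corresponding row of $\hat D$ as consisting only of $0$'s. For a row $r$ of $D$ let $W(r)$ be the label of the next row of $D$ below $r$, or $n+1$ if $r$ is the last row of $D$. A $0$ in $\hat D$ is restricted if some box to its left in the same row contains $+$, unrestricted otherwise. For a row $r$ of $D$ and a column $\ell$ of $D$ consider the conditions: (i) $\hat D$ has a $+$ in box $(r,\ell)$ (never for $r=a_n$); (ii) there is a row label $b'>r$ of $\hat D$ with a $+$ at $(b',\ell)$ in $\hat D$ such that every box $(b,\ell)$ of $\hat D$ with $b$ a row label of $\hat D$ and $r<b<b'$ contains an unrestricted $0$; (iii) every existing box $(b,\ell)$ of $\hat D$ with $b$ a row label of $\hat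 D$, $b>r$, contains an unrestricted $0$. Row types: (I) rows $b_u$ for which the box $(b_u,a_n)$ of $\hat D$ does not exist or contains $0$; (II) rows $b_u$ for which $(b_u,a_n)$ contains $+$ in $\hat D$; (III) the row $a_n$. Filling of a row $r$ of type (I) or (III), with $L=L_u$ (resp. $L=\infty$) and $W=W(r)$, for each box $(r,\ell)$ of $D$: if $r<\ell<\min(W,L)$ put $+$; if $W<\ell<L$ put $+$ if (i), (ii) or (iii) holds and $0$ otherwise; if $\ell\ge L$ put $0$. Filling of a row $r=b_u$ of type (II): for boxes $(r,\ell)$ with $\ell<a_n$ use the type (I) rule; for boxes with $\ell>a_n$ put $+$ exactly when $\hat D$ has $+$ at $(r,\ell)$, and $0$ otherwise. *)

theory Defs
  imports Main "HOL-Library.Extended_Nat"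
begin

section \<open>Fillings of Young diagrams\<close>

text \<open>
  A Young diagram inside a \<open>k \<times> (n - k)\<close> rectangle is given by its south-east boundary, a
  lattice path with steps \<open>1, \<dots>, n\<close> from the top-right to the bottom-left corner; the path is
  given by the set \<open>row_labels\<close> of its vertical steps. The remaining steps are the column labels.
  Row labels increase downwards and column labels increase to the left. The rows meeting the
  column of the horizontal step \<open>j\<close> are those whose vertical step precedes \<open>j\<close>, so the diagram
  has a box in row \<open>i\<close> and column \<open>j\<close> iff \<open>i < j\<close>.
  A filling with \<open>0\<close> and \<open>+\<close> is given by the set \<open>plusses\<close> of boxes that contain \<open>+\<close>.
\<close>

record filling =
  path_length :: nat
  row_labels :: "nat set"
  plusses :: "(nat \<times> nat) set"

definition col_labels :: "filling \<Rightarrow> nat set" where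
  "col_labels D = {1..path_length D} - row_labels D"

definition boxes :: "filling \<Rightarrow> (nat \<times> nat) set" where
  "boxes D = {(i, j). i \<in> row_labels D \<and> j \<in> col_labels D \<and> i < j}"

definition zeros :: "filling \<Rightarrow> (nat \<times> nat) set" where
  "zeros D = boxes D - plusses D"

definition le_diagram :: "nat \<Rightarrow> nat \<Rightarrow> filling \<Rightarrow> bool" where
  "le_diagram k n D \<longleftrightarrow>
     path_length D = n \<and> row_labels D \<subseteq> {1..n} \<and> card (row_labels D) = k \<and>
     plusses D \<subseteq> boxes D \<and>
     (\<forall>(i, j) \<in> zeros D.
        \<not> ((\<exists>i'<i. (i', j) \<in> plusses D) \<and> (\<exists>j'>j. (i, j') \<in> plusses D)))"

text \<open>
  The encoding of shapes agrees with the one by partitions: recording the lengths of the rows, from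
  top to bottom, is a bijection onto the partitions that fit inside the rectangle.
\<close>

definition row_lengths :: "nat \<Rightarrow> nat set \<Rightarrow> nat list" where
  "row_lengths n R = map (\<lambda>i. card {j \<in> {1..n} - R. i < j}) (sorted_list_of_set R)"

lemma row_lengths_nth:
  assumes R: "R \<subseteq> {1..n}" "card R = k" and r: "r < k"
  shows "row_lengths n R ! r + sorted_list_of_set R ! r = n - k + r + 1"
    and "row_lengths n R ! r \<le> n - k"
proof -
  let ?s = "sorted_list_of_set R"
  have fin: "finite R" using R finite_subset by blast
  have len: "length ?s = k" and set: "set ?s = R" and str: "sorted_wrt (<) ?s"
    using R fin by auto
  define i where "i = ?s ! r"
  have iR: "i \<in> R" unfolding i_def using set len r nth_mem by metis
  hence i: "1 \<le> i" "i \<le> n" using R by auto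
  have less: "?s ! a < ?s ! b \<longleftrightarrow> a < b" if "a < k" "b < k" for a b
    using sorted_wrt_nth_less[OF str, of a b] sorted_wrt_nth_less[OF str, of b a] that len
    by (cases a b rule: linorder_cases) auto
  have inj: "inj_on ((!) ?s) {..<k}"
  proof (rule inj_onI)
    fix a b assume "a \<in> {..<k}" "b \<in> {..<k}" "?s ! a = ?s ! b"
    thus "a = b" using less[of a b] less[of b a] by (cases a b rule: linorder_cases) auto
  qed
  have "{j \<in> R. i < j} = (!) ?s ` {r<..<k}"
  proof (intro set_eqI iffI)
    fix j assume j: "j \<in> {j \<in> R. i < j}"
    hence "j \<in> set ?s" unfolding set by simp
    then obtain b where "b < k" "?s ! b = j" "i < j"
      using j unfolding in_set_conv_nth len by blast
    thus "j \<in> (!) ?s ` {r<..<k}" using less[of r b] r by (auto simp: i_def)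
  next
    fix j assume "j \<in> (!) ?s ` {r<..<k}"
    then obtain b where b: "r < b" "b < k" "j = ?s ! b" by auto
    hence "?s ! b \<in> set ?s" by (intro nth_mem) (use b R in simp)
    thus "j \<in> {j \<in> R. i < j}" using b less[OF r] unfolding set i_def by simp
  qed
  hence "card {j \<in> R. i < j} = k - r - 1"
    using card_image[OF inj_on_subset[OF inj, of "{r<..<k}"]] by fastforce
  moreover have "card {j \<in> {1..n}. i < j} = n - i"
  proof -
    have "{j \<in> {1..n}. i < j} = {i<..n}" by auto
    thus ?thesis by simp
  qed
  moreover have "card {j \<in> {1..n}. i < j}
      = card {j \<in> {1..n} - R. i < j} + card {j \<in> R. i < j}"
  proof -
    have "{j \<in> {1..n}. i < j} = {j \<in> {1..n} - R. i < j} \<union> {j \<in> R. i < j}"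
      using R(1) by blast
    thus ?thesis using fin by (simp add: card_Un_disjoint disjoint_iff)
  qed
  moreover have lr: "row_lengths n R ! r = card {j \<in> {1..n} - R. i < j}"
    using len r by (simp add: row_lengths_def i_def)
  moreover have kn: "k \<le> n" using card_mono[OF _ R(1)] R by simp
  ultimately show "row_lengths n R ! r + ?s ! r = n - k + r + 1"
    using r i by (simp add: i_def)
  have "card ({1..n} - R) = n - k"
    using R fin by (simp add: card_Diff_subset)
  thus "row_lengths n R ! r \<le> n - k"
    unfolding lr using card_mono[of "{1..n} - R" "{j \<in> {1..n} - R. i < j}"] by fastforce
qed

lemma bij_betw_row_lengths:
  assumes "k \<le> n"
  shows "bij_betw (row_lengths n)
           {R. R \<subseteq> {1..n} \<and> card R = k}
           {\<mu>. length \<mu> = k \<and> sorted_wrt (\<ge>) \<mu> \<and> set \<mu> \<subseteq> {..n - k}}"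
proof (rule bij_betw_imageI)
  show "inj_on (row_lengths n) {R. R \<subseteq> {1..n} \<and> card R = k}"
  proof (rule inj_onI)
    fix R S assume R: "R \<in> {R. R \<subseteq> {1..n} \<and> card R = k}"
      and S: "S \<in> {R. R \<subseteq> {1..n} \<and> card R = k}"
      and eq: "row_lengths n R = row_lengths n S"
    have "finite R" "finite S" using R S finite_subset by blast+
    moreover have "sorted_list_of_set R = sorted_list_of_set S"
    proof (rule nth_equalityI)
      show "length (sorted_list_of_set R) = length (sorted_list_of_set S)"
        using R S by simp
      fix r assume "r < length (sorted_list_of_set R)"
      hence "r < k" using R by simp
      thus "sorted_list_of_set R ! r = sorted_list_of_set S ! r"
        using row_lengths_nth(1)[of R n k r] row_lengths_nth(1)[of S n k r] R S eq by simp
    qed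
    ultimately show "R = S" by (metis set_sorted_list_of_set)
  qed
  show "row_lengths n ` {R. R \<subseteq> {1..n} \<and> card R = k}
      = {\<mu>. length \<mu> = k \<and> sorted_wrt (\<ge>) \<mu> \<and> set \<mu> \<subseteq> {..n - k}}" (is "?A = ?B")
  proof (intro equalityI subsetI)
    fix \<mu> assume "\<mu> \<in> ?A"
    then obtain R where R: "R \<subseteq> {1..n}" "card R = k" and \<mu>: "\<mu> = row_lengths n R" by auto
    have fin: "finite R" using R finite_subset by blast
    have len: "length \<mu> = k" using R \<mu> by (simp add: row_lengths_def)
    have "sorted_wrt (\<ge>) \<mu>"
      unfolding \<mu> row_lengths_def sorted_wrt_map
      by (rule sorted_wrt_mono_rel[OF _ strict_sorted_list_of_set]) (auto intro!: card_mono)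
    moreover have "set \<mu> \<subseteq> {..n - k}"
      using row_lengths_nth(2)[OF R] len \<mu> by (auto simp: in_set_conv_nth)
    ultimately show "\<mu> \<in> ?B" using len by simp
  next
    fix \<mu> assume "\<mu> \<in> ?B"
    hence len: "length \<mu> = k" and dec: "sorted_wrt (\<ge>) \<mu>" and le: "\<And>r. r < k \<Longrightarrow> \<mu> ! r \<le> n - k"
      using nth_mem by auto
    define s where "s = map (\<lambda>r. n - k - \<mu> ! r + r + 1) [0..<k]"
    have str: "sorted_wrt (<) s"
      unfolding sorted_wrt_iff_nth_less s_def
    proof (intro allI impI)
      fix a b assume ab: "a < b" and "b < length (map (\<lambda>r. n - k - \<mu> ! r + r + 1) [0..<k])"
      hence b: "b < k" by simp
      have "\<mu> ! b \<le> \<mu> ! a" using sorted_wrt_nth_less[OF dec ab] b len by simp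
      thus "map (\<lambda>r. n - k - \<mu> ! r + r + 1) [0..<k] ! a
          < map (\<lambda>r. n - k - \<mu> ! r + r + 1) [0..<k] ! b" using ab b by simp
    qed
    define R where "R = set s"
    have sl: "sorted_list_of_set R = s"
      unfolding R_def by (rule strict_sorted_equal[OF str strict_sorted_list_of_set]) simp
    have R: "R \<subseteq> {1..n}" "card R = k"
    proof -
      show "R \<subseteq> {1..n}" using assms by (auto simp: R_def s_def)
      have "length (sorted_list_of_set R) = k" unfolding sl by (simp add: s_def)
      thus "card R = k" by simp
    qed
    have "row_lengths n R = \<mu>"
    proof (rule nth_equalityI)
      show "length (row_lengths n R) = length \<mu>" using R len by (simp add: row_lengths_def)
      fix r assume "r < length (row_lengths n R)"
      hence r: "r < k" using R by (simp add: row_lengths_def)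
      have "s ! r = n - k - \<mu> ! r + r + 1" using r by (simp add: s_def)
      thus "row_lengths n R ! r = \<mu> ! r"
        using row_lengths_nth(1)[OF R r] le[OF r] unfolding sl by simp
    qed
    thus "\<mu> \<in> ?A" using R by blast
  qed
qed


section \<open>Pipe dreams and decorated permutations\<close>

text \<open>
  \<open>pipe_left D r c\<close> is the exit label of a pipe that moves left in row \<open>r\<close> and whose next box is the
  one in the first column to the left of the step or column labelled \<open>c\<close>; \<open>pipe_up D c r\<close> is the
  exit label of a pipe that moves up in column \<open>c\<close> and whose next box is the one in the first row
  above the step or row labelled \<open>r\<close>. At a \<open>+\<close> the two directions are exchanged. Since the boxes
  of row \<open>r\<close> are in the columns with label above \<open>r\<close>, and those of column \<open>c\<close> in the rows with label
  below \<open>c\<close>, the pipes enter the diagram with \<open>pipe_left D i i\<close> and \<open>pipe_up D i i\<close>.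
\<close>

function pipe_left :: "filling \<Rightarrow> nat \<Rightarrow> nat \<Rightarrow> nat"
  and pipe_up :: "filling \<Rightarrow> nat \<Rightarrow> nat \<Rightarrow> nat"
where
  "pipe_left D r c =
     (if {j \<in> col_labels D. c < j} = {} then r
      else let j = Min {j \<in> col_labels D. c < j} in
        if (r, j) \<in> plusses D then pipe_up D j r else pipe_left D r j)"
| "pipe_up D c r =
     (if {i \<in> row_labels D. i < r} = {} then c
      else let i = Max {i \<in> row_labels D. i < r} in
        if (i, c) \<in> plusses D then pipe_left D i c else pipe_up D c i)"
  by pat_completeness auto
termination
proof (relation "measure (case_sum (\<lambda>(D, r, c). r + (path_length D - c))
                                  (\<lambda>(D, c, r). r + (path_length D - c)))", goal_cases)
  case 1
  show ?case by simp
next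
  case (2 D r c j)
  hence "j \<in> {j \<in> col_labels D. c < j}"
    unfolding 2(2) by (intro Min_in) (auto simp: col_labels_def)
  thus ?case by (auto simp: col_labels_def)
next
  case (3 D r c j)
  hence "j \<in> {j \<in> col_labels D. c < j}"
    unfolding 3(2) by (intro Min_in) (auto simp: col_labels_def)
  thus ?case by (auto simp: col_labels_def)
next
  case (4 D c r i)
  hence "i \<in> {i \<in> row_labels D. i < r}"
    unfolding 4(2) by (intro Max_in) auto
  thus ?case by auto
next
  case (5 D c r i)
  hence "i \<in> {i \<in> row_labels D. i < r}"
    unfolding 5(2) by (intro Max_in) auto
  thus ?case by auto
qed

declare pipe_left.simps [simp del] pipe_up.simps [simp del]

text \<open>
  A decorated permutation of \<open>{1..n}\<close>: a permutation, extended by the identity to all natural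
  numbers, whose fixed points in \<open>{1..n}\<close> are split into loops and co-loops.
\<close>

record decorated_perm =
  perm :: "nat \<Rightarrow> nat"
  loops :: "nat set"
  coloops :: "nat set"

definition pipe_perm :: "filling \<Rightarrow> nat \<Rightarrow> nat" where
  "pipe_perm D i =
     (if i \<in> row_labels D then pipe_left D i i
      else if i \<in> col_labels D then pipe_up D i i
      else i)"

definition dec_perm :: "filling \<Rightarrow> decorated_perm" where
  "dec_perm D =
     \<lparr>perm = pipe_perm D,
      loops = {i \<in> col_labels D. pipe_perm D i = i},
      coloops = {i \<in> row_labels D. pipe_perm D i = i}\<rparr>"

definition loopless :: "filling \<Rightarrow> bool" where
  "loopless D \<longleftrightarrow> loops (dec_perm D) = {}"

definition coloopless :: "filling \<Rightarrow> bool" where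
  "coloopless D \<longleftrightarrow> coloops (dec_perm D) = {}"

definition T_dual_perm :: "nat \<Rightarrow> (nat \<Rightarrow> nat) \<Rightarrow> nat \<Rightarrow> nat" where
  "T_dual_perm n p i =
     (if 1 \<le> i \<and> i < n then p (i + 1) else if i = n then p 1 else i)"

definition T_dual :: "nat \<Rightarrow> decorated_perm \<Rightarrow> decorated_perm" where
  "T_dual n p =
     \<lparr>perm = T_dual_perm n (perm p),
      loops = {},
      coloops = {i \<in> {1..n}. T_dual_perm n (perm p) i = i}\<rparr>"


section \<open>The algorithm\<close>

definition new_row :: "filling \<Rightarrow> nat" where
  "new_row E = perm (dec_perm E) 1"

definition out_rows :: "filling \<Rightarrow> nat set" where
  "out_rows E = insert (new_row E) (row_labels E)"

definition leftmost_plus :: "filling \<Rightarrow> nat \<Rightarrow> enat" where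
  "leftmost_plus E r =
     (if r = new_row E then \<infinity> else enat (Max {j. (r, j) \<in> plusses E}))"

definition next_row :: "filling \<Rightarrow> nat \<Rightarrow> nat" where
  "next_row E r =
     (if {i \<in> out_rows E. r < i} = {} then path_length E + 1
      else Min {i \<in> out_rows E. r < i})"

definition unrestricted_zero :: "filling \<Rightarrow> nat \<Rightarrow> nat \<Rightarrow> bool" where
  "unrestricted_zero E i j \<longleftrightarrow> (i, j) \<in> zeros E \<and> \<not> (\<exists>j'>j. (i, j') \<in> plusses E)"

definition cond_i :: "filling \<Rightarrow> nat \<Rightarrow> nat \<Rightarrow> bool" where
  "cond_i E r l \<longleftrightarrow> r \<noteq> new_row E \<and> (r, l) \<in> plusses E"

definition cond_ii :: "filling \<Rightarrow> nat \<Rightarrow> nat \<Rightarrow> bool" where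
  "cond_ii E r l \<longleftrightarrow>
     (\<exists>b' \<in> row_labels E. r < b' \<and> (b', l) \<in> plusses E \<and>
        (\<forall>b \<in> row_labels E. r < b \<and> b < b' \<longrightarrow> unrestricted_zero E b l))"

definition cond_iii :: "filling \<Rightarrow> nat \<Rightarrow> nat \<Rightarrow> bool" where
  "cond_iii E r l \<longleftrightarrow>
     (\<forall>b \<in> row_labels E. r < b \<and> (b, l) \<in> boxes E \<longrightarrow> unrestricted_zero E b l)"

definition type_II_row :: "filling \<Rightarrow> nat \<Rightarrow> bool" where
  "type_II_row E r \<longleftrightarrow> r \<in> row_labels E \<and> (r, new_row E) \<in> plusses E"

text \<open>No column label \<open>l\<close> of the new diagram equals \<open>next_row E r\<close>.\<close>

definition type_I_rule :: "filling \<Rightarrow> nat \<Rightarrow> nat \<Rightarrow> bool" where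
  "type_I_rule E r l \<longleftrightarrow>
     r < l \<and> enat l < min (enat (next_row E r)) (leftmost_plus E r) \<or>
     next_row E r < l \<and> enat l < leftmost_plus E r \<and>
       (cond_i E r l \<or> cond_ii E r l \<or> cond_iii E r l)"

definition out_plus :: "filling \<Rightarrow> nat \<Rightarrow> nat \<Rightarrow> bool" where
  "out_plus E r l \<longleftrightarrow>
     (if type_II_row E r \<and> new_row E < l then (r, l) \<in> plusses E else type_I_rule E r l)"

definition algorithm :: "filling \<Rightarrow> filling" where
  "algorithm E =
     \<lparr>path_length = path_length E,
      row_labels = out_rows E,
      plusses = {(r, l). r \<in> out_rows E \<and> l \<in> {1..path_length E} - out_rows E \<and> r < l \<and>
                         out_plus E r l}\<rparr>"

end

theory Submission
  imports Defs
begin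

text \<open>
  Let \<open>c\<^sub>r\<close> be the increasing cycle on the row label \<open>r\<close> and the columns of the \<open>+\<close>'s in row \<open>r\<close>.
  The pipes crossing row \<open>r\<close> are permuted by \<open>c\<^sub>r\<close>, so the decorated permutation is the product of
  the \<open>c\<^sub>r\<close>, the bottom row acting first. T-duality composes it on the right with the increasing
  cycle on \<open>{1..n}\<close>. This cycle is moved to the left past the rows, from the bottom row to the
  top row: at every stage it has become the increasing cycle on a set \<open>S t\<close> of labels, and
  \<open>c\<^sub>r \<circ> cyc (S r) = cyc (S (r - 1)) \<circ> d\<^sub>r\<close>, where \<open>d\<^sub>r\<close> is the cycle of row \<open>r\<close> of the new
  filling. Above all rows the remaining set is a singleton. The sets \<open>S t\<close> decrease upwards, which
  gives the Le-condition, and comparing cardinalities in each step gives the number of \<open>+\<close>'s.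
\<close>

section \<open>Increasing cycles\<close>

definition cyc :: "nat set \<Rightarrow> nat \<Rightarrow> nat" where
  "cyc A x =
     (if x \<notin> A then x
      else if \<exists>y\<in>A. x < y then LEAST y. y \<in> A \<and> x < y
      else LEAST y. y \<in> A)"

lemma cyc_notin: "x \<notin> A \<Longrightarrow> cyc A x = x"
  by (simp add: cyc_def)

lemma cyc_next:
  assumes "x \<in> A" "y \<in> A" "x < y" "\<And>z. z \<in> A \<Longrightarrow> x < z \<Longrightarrow> y \<le> z"
  shows "cyc A x = y"
proof -
  have "(LEAST y. y \<in> A \<and> x < y) = y"
    by (rule Least_equality) (use assms in auto)
  thus ?thesis using assms by (auto simp: cyc_def)
qed

lemma cyc_last:
  assumes "x \<in> A" "m \<in> A" "\<And>z. z \<in> A \<Longrightarrow> z \<le> x" "\<And>z. z \<in> A \<Longrightarrow> m \<le> z"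
  shows "cyc A x = m"
proof -
  have "(LEAST y. y \<in> A) = m"
    by (rule Least_equality) (use assms in auto)
  thus ?thesis using assms by (fastforce simp: cyc_def)
qed

lemma cyc_cases:
  assumes "x \<in> A"
  obtains (Next) "cyc A x \<in> A" "x < cyc A x" "\<And>z. z \<in> A \<Longrightarrow> x < z \<Longrightarrow> cyc A x \<le> z"
  | (Last) "cyc A x \<in> A" "\<And>z. z \<in> A \<Longrightarrow> z \<le> x" "\<And>z. z \<in> A \<Longrightarrow> cyc A x \<le> z"
proof (cases "\<exists>y\<in>A. x < y")
  case True
  hence c: "cyc A x = (LEAST y. y \<in> A \<and> x < y)" using assms by (simp add: cyc_def)
  from True obtain y where "y \<in> A \<and> x < y" by blast
  from LeastI[of "\<lambda>y. y \<in> A \<and> x < y", OF this] show ?thesis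
    using Next c Least_le[of "\<lambda>y. y \<in> A \<and> x < y"] by simp
next
  case False
  hence c: "cyc A x = (LEAST y. y \<in> A)" using assms by (auto simp: cyc_def)
  from LeastI[of "\<lambda>y. y \<in> A", OF assms] show ?thesis
    using Last c False Least_le[of "\<lambda>y. y \<in> A"] by (simp add: not_less)
qed

lemma cyc_singleton: "cyc {a} = id"
  by (auto simp: fun_eq_iff cyc_def intro: Least_equality)

text \<open>The right factor acts first: it makes the steps beyond \<open>a\<close> and sends the
  maximum of \<open>S\<close> to \<open>a\<close>, from where the left factor goes on to the
  minimum. In this way the cycle passes the new row \<open>a\<close>, whose old row cycle is the
  identity.\<close>

lemma cyc_split:
  assumes "a \<in> S"
  shows "cyc (S \<inter> {..a}) \<circ> cyc (insert a (S \<inter> {a<..})) = cyc S"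
proof
  fix x
  let ?A = "S \<inter> {..a}" and ?B = "insert a (S \<inter> {a<..})"
  consider "x \<notin> S" | "x \<in> S" "x < a" | "x \<in> S" "a \<le> x" by force
  thus "(cyc ?A \<circ> cyc ?B) x = cyc S x"
  proof cases
    case 1
    hence "cyc ?A x = x" "cyc ?B x = x" "cyc S x = x"
      using assms by (auto intro!: cyc_notin)
    thus ?thesis by simp
  next
    case 2
    have "cyc ?A x = cyc S x"
      using 2(1) by (cases rule: cyc_cases) (use 2 assms in \<open>force intro!: cyc_next\<close>)+
    moreover have "cyc ?B x = x" using 2 by (auto simp: cyc_notin)
    ultimately show ?thesis by simp
  next
    case 3
    show ?thesis
      using 3(1)
    proof (cases rule: cyc_cases)
      case Next
      have "cyc ?B x = cyc S x" using 3 Next by (intro cyc_next) auto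
      thus ?thesis using 3 Next by (simp add: cyc_notin)
    next
      case Last
      have "cyc ?B x = a" using 3 Last by (intro cyc_last) auto
      moreover have "cyc ?A a = cyc S x" using assms Last by (intro cyc_last) auto
      ultimately show ?thesis by simp
    qed
  qed
qed

text \<open>Up to \<open>L\<close>, where \<open>P\<close> lies in \<open>S\<close>, an
  \<open>S\<close>-step is followed by a \<open>P\<close>-step on both sides of the equation. Beyond
  \<open>L\<close> the two sets are disjoint, so their steps do not interact, and \<open>P\<close>
  and \<open>S\<close> can change factors there.\<close>

lemma cyc_exchange:
  assumes b: "b \<in> S" and L: "L \<in> P" and bP: "\<And>p. p \<in> P \<Longrightarrow> b < p"
    and PS: "P \<inter> {..L} \<subseteq> S" and dis: "P \<inter> {L<..} \<inter> S = {}"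
  shows "cyc (S \<inter> {..<b} \<union> P \<inter> {..L} \<union> S \<inter> {L<..})
           \<circ> cyc (insert b (S \<inter> {b<..<L} \<union> P \<inter> {L<..}))
         = cyc (insert b P) \<circ> cyc S" (is "cyc ?S' \<circ> cyc ?C = _")
proof
  fix x
  have bL: "b < L" using bP L by simp
  have LS: "L \<in> S" using subsetD[OF PS, of L] L by simp
  \<comment> \<open>\<open>m\<close> is the image of \<open>b\<close> under
    \<open>cyc (insert b P)\<close>. As \<open>b\<close> is not in \<open>?S'\<close>, it takes the
    place of \<open>b\<close> there.\<close>
  define m where "m = (LEAST p. p \<in> P)"
  have m: "m \<in> P" "\<And>p. p \<in> P \<Longrightarrow> m \<le> p"
    unfolding m_def using L by (auto intro: LeastI Least_le)
  hence mL: "b < m" "m \<le> L" using bP L by auto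
  have cb: "cyc (insert b P) b = m" using m mL by (intro cyc_next) auto
  consider "x \<notin> S" "x \<notin> P" | "x \<notin> S" "x \<in> P" "L < x" | "x \<in> S" "x < b"
    | "x \<in> S" "b \<le> x" "x < L" | "x \<in> S" "L \<le> x"
    using PS by force
  thus "(cyc ?S' \<circ> cyc ?C) x = (cyc (insert b P) \<circ> cyc S) x"
  proof cases
    case 1
    have "cyc ?C x = x" "cyc ?S' x = x" "cyc (insert b P) x = x"
      using 1 b by (auto intro!: cyc_notin)
    thus ?thesis using 1 by (simp add: cyc_notin)
  next
    case 2
    have "x \<in> insert b P" using 2 by simp
    hence "cyc ?C x = cyc (insert b P) x \<and> cyc (insert b P) x \<notin> ?S'"
    proof (cases rule: cyc_cases)
      case Next
      hence "cyc ?C x = cyc (insert b P) x" using 2 bL by (intro cyc_next) auto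
      thus ?thesis using Next 2 dis bL by auto
    next
      case Last
      have e: "cyc (insert b P) x = b" using Last bP 2 by force
      have "cyc ?C x = b"
      proof (rule cyc_last)
        fix z assume "z \<in> ?C"
        thus "z \<le> x" using Last 2 bL by auto
      qed (use 2 bP in \<open>auto intro: less_imp_le\<close>)
      thus ?thesis using e bP bL by auto
    qed
    thus ?thesis using 2 by (simp add: cyc_notin)
  next
    case 3
    have c: "cyc ?C x = x" using 3 bL by (auto simp: cyc_notin)
    show ?thesis
      using 3(1)
    proof (cases rule: cyc_cases)
      case Next
      show ?thesis
      proof (cases "cyc S x = b")
        case True
        have "cyc ?S' x = m"
        proof (rule cyc_next)
          fix z assume "z \<in> ?S'" "x < z"
          thus "m \<le> z" using m(2) mL Next(3)[of z] True by auto
        qed (use 3 m mL in auto)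
        thus ?thesis using c cb True by simp
      next
        case False
        hence lt: "cyc S x < b" using Next(3)[of b] b 3 by simp
        have "cyc ?S' x = cyc S x"
        proof (rule cyc_next)
          fix z assume "z \<in> ?S'" "x < z"
          thus "cyc S x \<le> z" using lt bP[of z] Next(3)[of z] by auto
        qed (use 3 lt Next in auto)
        moreover have "cyc (insert b P) (cyc S x) = cyc S x"
          using lt bP[of "cyc S x"] by (auto intro!: cyc_notin)
        ultimately show ?thesis using c by simp
      qed
    next
      case Last
      thus ?thesis using 3 b by force
    qed
  next
    case 4
    show ?thesis
      using 4(1)
    proof (cases rule: cyc_cases)
      case Next
      define y where "y = cyc S x"
      have y: "y \<in> S" "x < y" "\<And>z. z \<in> S \<Longrightarrow> x < z \<Longrightarrow> y \<le> z" "y \<le> L"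
        unfolding y_def using Next LS 4 by auto
      show ?thesis
      proof (cases "y = L")
        case False
        hence yL: "y < L" using y by simp
        have c: "cyc ?C x = y"
        proof (rule cyc_next)
          fix z assume "z \<in> ?C" "x < z"
          thus "y \<le> z" using y(3)[of z] yL 4 by auto
        qed (use 4 y yL in auto)
        have "cyc ?S' y = cyc (insert b P) y"
        proof (cases "y \<in> P")
          case True
          hence "y \<in> insert b P" by simp
          thus ?thesis
          proof (cases rule: cyc_cases)
            case Next
            have "cyc (insert b P) y \<le> L" using Next(3)[of L] L yL by simp
            moreover have "cyc (insert b P) y \<in> P" using Next y 4 by auto
            ultimately show ?thesis using Next True yL
            proof (intro cyc_next)
              fix z assume z: "z \<in> ?S'" "y < z"
              show "cyc (insert b P) y \<le> z"
                using z Next(3)[of z] \<open>cyc (insert b P) y \<le> L\<close> y 4 by auto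
            qed auto
          next
            case Last
            thus ?thesis using L yL by force
          qed
        next
          case False
          thus ?thesis using y yL 4 by (subst (1 2) cyc_notin) auto
        qed
        thus ?thesis using c by (simp add: y_def)
      next
        case True
        \<comment> \<open>\<open>L\<close> is missing from \<open>?C\<close>, so the step from
          \<open>x\<close> goes at once to the successor of \<open>L\<close> in
          \<open>insert b P\<close>, which \<open>cyc ?S'\<close> fixes.\<close>
        have "L \<in> insert b P" using L by simp
        hence "cyc ?C x = cyc (insert b P) L \<and> cyc (insert b P) L \<notin> ?S'"
        proof (cases rule: cyc_cases)
          case Next
          have "cyc ?C x = cyc (insert b P) L"
          proof (rule cyc_next)
            fix z assume z: "z \<in> ?C" "x < z"
            show "cyc (insert b P) L \<le> z" using z Next(3)[of z] y(3)[of z] True 4 by auto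
          qed (use Next 4 bL in auto)
          thus ?thesis using Next dis bL by auto
        next
          case Last
          have e: "cyc (insert b P) L = b" using Last(1) Last(3)[of b] bP by force
          have "cyc ?C x = b"
          proof (rule cyc_last)
            fix z assume z: "z \<in> ?C"
            show "z \<le> x" using z Last(2)[of z] y(3)[of z] True 4 by force
          qed (use 4 bP bL in \<open>auto intro: less_imp_le\<close>)
          thus ?thesis using e bP bL by auto
        qed
        thus ?thesis using True by (simp add: y_def cyc_notin)
      qed
    next
      case Last
      thus ?thesis using 4 LS by force
    qed
  next
    case 5
    have c: "cyc ?C x = x" using 5 bL dis by (auto intro!: cyc_notin)
    have xS': "x \<in> ?S'" using 5 L by (cases "x = L") auto
    show ?thesis
      using 5(1)
    proof (cases rule: cyc_cases)
      case Next
      have "cyc ?S' x = cyc S x"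
      proof (rule cyc_next)
        fix z assume z: "z \<in> ?S'" "x < z"
        show "cyc S x \<le> z" using z Next(3)[of z] 5 bL by auto
      qed (use Next 5 xS' in auto)
      moreover have "cyc (insert b P) (cyc S x) = cyc S x"
        using Next 5 bL dis by (intro cyc_notin) auto
      ultimately show ?thesis using c by simp
    next
      case Last
      \<comment> \<open>If the wrap-around of \<open>S\<close> lands at \<open>b\<close>, then
        \<open>b\<close> is the minimum of \<open>S\<close>, and \<open>m\<close> is that of
        \<open>?S'\<close>.\<close>
      show ?thesis
      proof (cases "cyc S x = b")
        case True
        have "cyc ?S' x = m"
        proof (rule cyc_last)
          fix z assume z: "z \<in> ?S'"
          show "z \<le> x" using z Last(2)[of z] PS by auto
          show "m \<le> z" using z m(2)[of z] Last(3)[of z] True mL by auto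
        qed (use xS' m mL in auto)
        thus ?thesis using c cb True by simp
      next
        case False
        hence lt: "cyc S x < b" using Last(3)[OF b] by simp
        have "cyc ?S' x = cyc S x"
        proof (rule cyc_last)
          fix z assume z: "z \<in> ?S'"
          show "z \<le> x" using z Last(2)[of z] PS by auto
          show "cyc S x \<le> z" using z Last(3)[of z] PS by auto
        qed (use xS' Last lt in auto)
        moreover have "cyc (insert b P) (cyc S x) = cyc S x"
          using lt bP[of "cyc S x"] by (intro cyc_notin) auto
        ultimately show ?thesis using c by simp
      qed
    qed
  qed
qed

text \<open>Together the two new sets keep all of \<open>P\<close>, and all of \<open>S\<close>
  except \<open>b\<close> and \<open>L\<close>. These two losses become the \<open>2 * k\<close> of
  the dimension formula.\<close>

lemma card_exchange:
  fixes S P :: "nat set"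
  assumes fin: "finite S" "finite P"
    and b: "b \<in> S" and L: "L \<in> P" and bP: "\<And>p. p \<in> P \<Longrightarrow> b < p"
    and PS: "P \<inter> {..L} \<subseteq> S"
  shows "card (S \<inter> {b<..<L} \<union> P \<inter> {L<..}) + card (S \<inter> {..<b} \<union> P \<inter> {..L} \<union> S \<inter> {L<..}) + 2
         = card P + card S"
proof -
  have bL: "b < L" using bP L by simp
  have LS: "L \<in> S" using subsetD[OF PS, of L] L by simp
  have "S = (S \<inter> {..<b}) \<union> ({b} \<union> (S \<inter> {b<..<L} \<union> ({L} \<union> S \<inter> {L<..})))"
    using b bL LS by auto
  hence "card S = card \<dots>" by simp
  also have "\<dots> = card (S \<inter> {..<b}) + (1 + (card (S \<inter> {b<..<L}) + (1 + card (S \<inter> {L<..}))))"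
    using fin bL by (subst card_Un_disjoint; (force simp: card_Un_disjoint)?)+
  finally have 1: "card S = card (S \<inter> {..<b}) + card (S \<inter> {b<..<L}) + card (S \<inter> {L<..}) + 2"
    by simp
  have "P = P \<inter> {..L} \<union> P \<inter> {L<..}" by auto
  hence "card P = card \<dots>" by simp
  also have "\<dots> = card (P \<inter> {..L}) + card (P \<inter> {L<..})"
    using fin by (intro card_Un_disjoint) auto
  finally have 2: "card P = card (P \<inter> {..L}) + card (P \<inter> {L<..})" .
  have 3: "card (S \<inter> {b<..<L} \<union> P \<inter> {L<..}) = card (S \<inter> {b<..<L}) + card (P \<inter> {L<..})"
    using fin by (intro card_Un_disjoint) auto
  have "card (S \<inter> {..<b} \<union> P \<inter> {..L} \<union> S \<inter> {L<..})
      = card (S \<inter> {..<b} \<union> P \<inter> {..L}) + card (S \<inter> {L<..})"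
    using fin bL by (intro card_Un_disjoint) auto
  also have "card (S \<inter> {..<b} \<union> P \<inter> {..L}) = card (S \<inter> {..<b}) + card (P \<inter> {..L})"
    using fin by (intro card_Un_disjoint) (auto dest: bP)
  finally show ?thesis using 1 2 3 by simp
qed


section \<open>The decorated permutation as a product of row cycles\<close>

definition row_plus :: "filling \<Rightarrow> nat \<Rightarrow> nat set" where
  "row_plus D r = {j. (r, j) \<in> plusses D}"

text \<open>Lower rows act first. A label that is not a row contributes the cycle on a singleton,
  the identity, so the recursion can run over all labels.\<close>

fun row_prod :: "filling \<Rightarrow> nat \<Rightarrow> nat \<Rightarrow> nat" where
  "row_prod D 0 = id"
| "row_prod D (Suc t) = row_prod D t \<circ> cyc (insert (Suc t) (row_plus D (Suc t)))"

locale plusses_in_boxes =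
  fixes D :: filling
  assumes plus_boxes: "plusses D \<subseteq> boxes D"
    and rows: "row_labels D \<subseteq> {1..path_length D}"
begin

lemma row_plusD:
  assumes "j \<in> row_plus D r"
  shows "r \<in> row_labels D" "j \<in> col_labels D" "r < j"
  using assms plus_boxes by (auto simp: row_plus_def boxes_def)

lemma row_plus_nonrow: "r \<notin> row_labels D \<Longrightarrow> row_plus D r = {}"
  using row_plusD(1) by blast

lemma row_prod_nonrows:
  assumes "\<And>r. u < r \<Longrightarrow> r \<le> t \<Longrightarrow> r \<notin> row_labels D" "u \<le> t"
  shows "row_prod D t = row_prod D u"
  using assms(2,1)
proof (induction t rule: dec_induct)
  case (step t)
  hence "row_plus D (Suc t) = {}" by (intro row_plus_nonrow) simp
  thus ?case using step by (simp add: cyc_singleton)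
qed simp

text \<open>The cycle of row \<open>r\<close> moves only labels that are at least
  \<open>r\<close>.\<close>

lemma row_prod_stable:
  assumes "x \<le> u" "u \<le> t"
  shows "row_prod D t x = row_prod D u x"
  using assms(2)
proof (induction t rule: dec_induct)
  case (step t)
  have "x \<notin> insert (Suc t) (row_plus D (Suc t))"
    using step assms(1) by (auto dest: row_plusD)
  thus ?case using step by (simp add: cyc_notin)
qed simp

text \<open>The plusses lie in columns, so a row label belongs to no row cycle but its own.\<close>

lemma row_prod_row:
  assumes "x \<in> row_labels D" "t < x"
  shows "row_prod D t x = x"
  using assms(2)
proof (induction t)
  case (Suc t)
  have "x \<notin> insert (Suc t) (row_plus D (Suc t))"
    using Suc assms(1) by (auto dest: row_plusD(2) simp: col_labels_def)
  thus ?case using Suc by (simp add: cyc_notin)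
qed simp

lemma row_prod_outside:
  assumes "x \<notin> {1..path_length D}" "t \<le> path_length D"
  shows "row_prod D t x = x"
  using assms(2)
proof (induction t)
  case (Suc t)
  have "x \<notin> insert (Suc t) (row_plus D (Suc t))"
    using Suc assms(1) by (auto dest: row_plusD(2) simp: col_labels_def)
  thus ?case using Suc by (simp add: cyc_notin)
qed simp

text \<open>A row cycle lowers a label only by sending its maximum to the row label, and the rows
  above fix that row label. So a label that is ever lowered ends at a row label.\<close>

lemma row_prod_ge:
  assumes "row_prod D t x \<notin> row_labels D"
  shows "x \<le> row_prod D t x"
  using assms
proof (induction t arbitrary: x)
  case (Suc t)
  let ?A = "insert (Suc t) (row_plus D (Suc t))"
  let ?y = "cyc ?A x"
  have y: "?y \<le> row_prod D t ?y" using Suc by simp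
  have "x \<le> ?y"
  proof (rule ccontr)
    assume "\<not> x \<le> ?y"
    hence lt: "?y < x" by simp
    hence "x \<in> ?A" using cyc_notin[of x ?A] by auto
    hence yx: "?y = Suc t"
    proof (cases rule: cyc_cases)
      case Last
      show ?thesis using Last(1) Last(3)[of "Suc t"] by (auto dest: row_plusD)
    qed (use lt in simp)
    with lt \<open>x \<in> ?A\<close> have "x \<in> row_plus D (Suc t)" by auto
    hence "Suc t \<in> row_labels D" by (rule row_plusD)
    thus False using Suc.prems row_prod_row[of "Suc t" t] yx by simp
  qed
  thus ?case using y by simp
qed simp

text \<open>\<open>row_prod D (r - 1)\<close> is the effect of the rows strictly above
  \<open>r\<close>. A pipe moving left from \<open>c\<close> turns up at the next plus, or leaves at
  \<open>r\<close>; this is not written with \<open>cyc\<close> because \<open>c\<close> need not be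
  the column of a plus. The induction follows the recursion of the pipes.\<close>

lemma pipes:
  shows "r \<in> row_labels D \<Longrightarrow> r \<le> c \<Longrightarrow>
           pipe_left D r c = row_prod D (r - 1)
             (if \<exists>j\<in>row_plus D r. c < j then LEAST j. j \<in> row_plus D r \<and> c < j else r)"
    and "r \<le> c \<Longrightarrow> pipe_up D c r = row_prod D (r - 1) c"
proof (induction D\<equiv>D r c and D\<equiv>D c r rule: pipe_left_pipe_up.induct)
  case (1 r c)
  show ?case
  proof (cases "{j \<in> col_labels D. c < j} = {}")
    case True
    hence "\<not> (\<exists>j\<in>row_plus D r. c < j)" by (auto dest: row_plusD)
    thus ?thesis using True 1 row_prod_row[of r "r - 1"] rows
      by (subst pipe_left.simps) (auto simp: Suc_le_eq)
  next
    case False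
    define j where "j = Min {j \<in> col_labels D. c < j}"
    have "finite {j \<in> col_labels D. c < j}" by (simp add: col_labels_def)
    hence j: "j \<in> col_labels D" "c < j" "\<And>j'. j' \<in> col_labels D \<Longrightarrow> c < j' \<Longrightarrow> j \<le> j'"
      using Min_in[OF _ False] unfolding j_def by auto
    show ?thesis
    proof (cases "(r, j) \<in> plusses D")
      case True
      have "pipe_left D r c = pipe_up D j r"
        unfolding pipe_left.simps[of D r c] Let_def if_not_P[OF False] j_def[symmetric]
        using True by simp
      also have "\<dots> = row_prod D (r - 1) j"
        using 1(1)[OF False j_def True] 1 j by simp
      also have "j = (LEAST j. j \<in> row_plus D r \<and> c < j)"
        using True j row_plusD(2) by (intro Least_equality[symmetric]) (auto simp: row_plus_def)
      finally show ?thesis using True j by (auto simp: row_plus_def)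
    next
      case np: False
      have *: "j' \<in> row_plus D r \<and> c < j' \<longleftrightarrow> j' \<in> row_plus D r \<and> j < j'" for j'
        using np j(2) row_plusD(2)[of j' r] j(3)[of j']
        by (auto simp: row_plus_def order.strict_iff_order[of j])
      have "pipe_left D r c = pipe_left D r j"
        unfolding pipe_left.simps[of D r c] Let_def if_not_P[OF False] j_def[symmetric]
        using np by simp
      also have "\<dots> = row_prod D (r - 1)
             (if \<exists>j'\<in>row_plus D r. j < j' then LEAST j'. j' \<in> row_plus D r \<and> j < j' else r)"
        using 1(2)[OF False j_def np] 1 j by simp
      finally show ?thesis using * by (auto simp: Bex_def)
    qed
  qed
next
  case (2 c r)
  show ?case
  proof (cases "{i \<in> row_labels D. i < r} = {}")
    case True
    have "row_prod D (r - 1) = row_prod D 0"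
      using True rows by (intro row_prod_nonrows) auto
    thus ?thesis using True by (subst pipe_up.simps) simp
  next
    case False
    define i where "i = Max {i \<in> row_labels D. i < r}"
    have "finite {i \<in> row_labels D. i < r}" by simp
    hence i: "i \<in> row_labels D" "i < r" "\<And>i'. i' \<in> row_labels D \<Longrightarrow> i' < r \<Longrightarrow> i' \<le> i"
      using Max_in[OF _ False] unfolding i_def by auto
    have i0: "0 < i" using i rows by auto
    have "row_prod D (r - 1) = row_prod D i"
      using i by (intro row_prod_nonrows) (auto simp: not_less[symmetric])
    moreover have "row_prod D i = row_prod D (i - 1) \<circ> cyc (insert i (row_plus D i))"
      using i0 by (cases i) simp_all
    ultimately have e: "row_prod D (r - 1) c = row_prod D (i - 1) (cyc (insert i (row_plus D i)) c)"
      by simp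
    show ?thesis
    proof (cases "(i, c) \<in> plusses D")
      case True
      have ic: "i < c" using i 2 by simp
      have "pipe_up D c r = pipe_left D i c"
        unfolding pipe_up.simps[of D c r] Let_def if_not_P[OF False] i_def[symmetric]
        using True by simp
      also have "\<dots> = row_prod D (i - 1)
             (if \<exists>j\<in>row_plus D i. c < j then LEAST j. j \<in> row_plus D i \<and> c < j else i)"
        using 2(1)[OF False i_def True] i ic by simp
      \<comment> \<open>A pipe that comes up to a plus and turns left runs to the next plus or to
        the exit, which is one step of the row cycle.\<close>
      also have "(if \<exists>j\<in>row_plus D i. c < j then LEAST j. j \<in> row_plus D i \<and> c < j else i)
          = cyc (insert i (row_plus D i)) c"
      proof (cases "\<exists>j\<in>row_plus D i. c < j")
        case ex: True
        have "(j \<in> insert i (row_plus D i) \<and> c < j) = (j \<in> row_plus D i \<and> c < j)" for j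
          using ic by auto
        thus ?thesis using ex True ic by (simp add: cyc_def row_plus_def)
      next
        case nex: False
        moreover have "c \<in> row_plus D i" using True by (simp add: row_plus_def)
        ultimately have "cyc (insert i (row_plus D i)) c = i"
          using ic by (intro cyc_last) (auto simp: not_less intro: less_imp_le dest: row_plusD(3))
        thus ?thesis using nex by simp
      qed
      finally show ?thesis using e by simp
    next
      case np: False
      have "pipe_up D c r = pipe_up D c i"
        unfolding pipe_up.simps[of D c r] Let_def if_not_P[OF False] i_def[symmetric]
        using np by simp
      also have "\<dots> = row_prod D (i - 1) c"
        using 2(2)[OF False i_def np] i 2 by simp
      also have "cyc (insert i (row_plus D i)) c = c"
        using np i 2 by (intro cyc_notin) (auto simp: row_plus_def)
      hence "row_prod D (i - 1) c = row_prod D (r - 1) c" using e by simp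
      finally show ?thesis .
    qed
  qed
qed

lemma cyc_row:
  "cyc (insert r (row_plus D r)) r
     = (if \<exists>j\<in>row_plus D r. r < j then LEAST j. j \<in> row_plus D r \<and> r < j else r)"
proof (cases "\<exists>j\<in>row_plus D r. r < j")
  case True
  have "(j \<in> insert r (row_plus D r) \<and> r < j) = (j \<in> row_plus D r \<and> r < j)" for j by auto
  thus ?thesis using True by (simp add: cyc_def)
next
  case False
  hence "row_plus D r = {}" using row_plusD(3) by blast
  thus ?thesis by (simp add: cyc_singleton)
qed

text \<open>A pipe entering at step \<open>i\<close> meets no row with label above \<open>i\<close>,
  and the cycles of those rows fix \<open>i\<close>.\<close>

theorem pipe_perm_eq: "pipe_perm D = row_prod D (path_length D)"
proof
  fix i
  consider "i \<in> row_labels D" | "i \<in> col_labels D" "i \<notin> row_labels D"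
    | "i \<notin> {1..path_length D}" by (auto simp: col_labels_def)
  thus "pipe_perm D i = row_prod D (path_length D) i"
  proof cases
    case 1
    hence i: "0 < i" "i \<le> path_length D" using rows by auto
    have "pipe_perm D i = row_prod D (i - 1) (cyc (insert i (row_plus D i)) i)"
      using 1 by (simp add: pipe_perm_def pipes(1) cyc_row)
    also have "\<dots> = row_prod D i i" using i by (cases i) auto
    finally show ?thesis using i row_prod_stable[of i i "path_length D"] by simp
  next
    case 2
    hence i: "0 < i" "i \<le> path_length D" by (auto simp: col_labels_def)
    have "row_plus D i = {}" using row_plus_nonrow 2 by auto
    hence "row_prod D i i = row_prod D (i - 1) i"
      using i by (cases i) (auto simp: cyc_singleton)
    thus ?thesis using 2 i row_prod_stable[of i i "path_length D"]
      by (simp add: pipe_perm_def pipes(2))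
  next
    case 3
    hence "i \<notin> row_labels D" "i \<notin> col_labels D" using rows by (auto simp: col_labels_def)
    thus ?thesis using row_prod_outside[OF 3] by (simp add: pipe_perm_def)
  qed
qed

end


section \<open>The state sets of the algorithm\<close>

locale coloopless_le_diagram =
  fixes k n :: nat and E :: filling
  assumes n_pos: "n \<ge> 1"
    and le_E: "le_diagram k n E"
    and coloopless_E: "coloopless E"
begin

abbreviation R where "R \<equiv> row_labels E"
abbreviation P where "P \<equiv> row_plus E"
abbreviation a where "a \<equiv> new_row E"

lemma path_length_E [simp]: "path_length E = n"
  using le_E by (simp add: le_diagram_def)

sublocale plusses_in_boxes E
  using le_E by unfold_locales (auto simp: le_diagram_def)

lemma R_range: "r \<in> R \<Longrightarrow> 1 \<le> r \<and> r \<le> n"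
  using rows by auto

lemma finite_R [simp]: "finite R"
  using rows finite_subset by blast

lemma P_range: "p \<in> P r \<Longrightarrow> 1 \<le> p \<and> p \<le> n \<and> p \<notin> R"
  using row_plusD(2)[of p r] by (simp add: col_labels_def)

lemma finite_P [simp]: "finite (P r)"
  by (rule finite_subset[of _ "{1..n}"]) (use P_range in auto)

lemma le_condition:
  assumes "(i, j) \<in> zeros E" "j \<in> P i'" "i' < i" "j' \<in> P i"
  shows "j' \<le> j"
  using le_E assms by (fastforce simp: le_diagram_def row_plus_def not_less[symmetric])

text \<open>No other row cycle moves the label \<open>r\<close>, so a row without plusses would make
  it a co-loop.\<close>

lemma P_nonempty:
  assumes "r \<in> R"
  shows "P r \<noteq> {}"
proof
  assume e: "P r = {}"
  have r: "1 \<le> r" "r \<le> n" using R_range assms by auto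
  have "pipe_perm E r = row_prod E r r"
    using row_prod_stable[of r r n] r by (simp add: pipe_perm_eq)
  also have "\<dots> = r"
    using r e row_prod_row[OF assms, of "r - 1"] by (cases r) (simp_all add: cyc_singleton)
  finally show False
    using coloopless_E assms by (simp add: coloopless_def dec_perm_def)
qed

text \<open>Only row \<open>1\<close> can move the label \<open>1\<close>. Hence \<open>a\<close> is
  the column of the rightmost plus of row \<open>1\<close>, or \<open>1\<close> itself if
  \<open>1\<close> is a column label.\<close>

lemma a_eq: "a = cyc (insert 1 (P 1)) 1"
proof -
  have "a = row_prod E 1 1"
    using row_prod_stable[of 1 1 n] n_pos by (simp add: new_row_def dec_perm_def pipe_perm_eq)
  thus ?thesis by simp
qed

lemma a_row1:
  assumes "1 \<in> R"
  shows "a \<in> P 1" "\<And>p. p \<in> P 1 \<Longrightarrow> a \<le> p"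
proof -
  obtain p where p: "p \<in> P 1" using P_nonempty[OF assms] by blast
  define m where "m = (LEAST p. p \<in> P 1)"
  have m: "m \<in> P 1" "\<And>p. p \<in> P 1 \<Longrightarrow> m \<le> p"
    unfolding m_def using p by (auto intro: LeastI Least_le)
  have "a = m" unfolding a_eq
    by (rule cyc_next) (use m row_plusD(3)[of m 1] in auto)
  thus "a \<in> P 1" "\<And>p. p \<in> P 1 \<Longrightarrow> a \<le> p" using m by auto
qed

lemma a_no_row1: "1 \<notin> R \<Longrightarrow> a = 1"
  using row_plus_nonrow[of 1] by (simp add: a_eq cyc_singleton)

lemma a_range: "1 \<le> a" "a \<le> n" and a_notin_R: "a \<notin> R"
proof -
  have "1 \<le> a \<and> a \<le> n \<and> a \<notin> R"
  proof (cases "1 \<in> R")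
    case True
    from P_range[OF a_row1(1)[OF this]] show ?thesis .
  next
    case False
    thus ?thesis using a_no_row1 n_pos by simp
  qed
  thus "1 \<le> a" "a \<le> n" "a \<notin> R" by auto
qed

text \<open>In a type (I) row above \<open>a\<close>, the zero in column \<open>a\<close> has the \<open>+\<close> in box \<open>(1, a)\<close> above it.\<close>

lemma P_less_a:
  assumes "r \<in> R" "r < a" "a \<notin> P r" "p \<in> P r"
  shows "p < a"
proof -
  have "1 \<in> R" using a_no_row1 assms R_range by fastforce
  hence a1: "a \<in> P 1" by (rule a_row1)
  have "r \<noteq> 1" using a1 assms by auto
  hence "1 < r" using R_range assms by fastforce
  moreover have "(r, a) \<in> zeros E"
    using assms a_range a_notin_R by (auto simp: zeros_def boxes_def col_labels_def row_plus_def)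
  ultimately have "p \<le> a" using le_condition a1 assms by blast
  thus ?thesis using assms by (cases "p = a") auto
qed

text \<open>
  For a column label, conditions (ii) and (iii) together say that the first row below
  \<open>t\<close> whose box in that column is not an unrestricted zero contains a \<open>+\<close>, or does not exist.
  Condition (i) is redundant: by the Le-condition it implies (ii) or (iii).
\<close>

definition S\<^sub>0 :: "nat \<Rightarrow> nat set" where
  "S\<^sub>0 t = {l \<in> {1..n}. if l \<in> R then l \<le> t else cond_ii E t l \<or> cond_iii E t l}"

text \<open>The cut at \<open>a\<close> is the effect of the new row: above it, the labels beyond
  \<open>a\<close> have been split off into its cycle by \<open>cyc_split\<close>.\<close>

definition S :: "nat \<Rightarrow> nat set" where
  "S t = (if t < a then S\<^sub>0 t \<inter> {..a} else S\<^sub>0 t)"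

text \<open>
  In a row of type (II) the exchange of cycles happens at column \<open>a\<close>, where \<open>S\<close> is cut off; in a
  row of type (I) it happens at the leftmost \<open>+\<close>.
\<close>

definition corner :: "nat \<Rightarrow> nat" where
  "corner r = (if a \<in> P r then a else Max (P r))"

section \<open>How the state sets change from row to row\<close>

lemma S0_subset: "S\<^sub>0 t \<subseteq> {1..n}" and S_subset_S0: "S t \<subseteq> S\<^sub>0 t"
  by (auto simp: S\<^sub>0_def S_def)

lemma finite_S0 [simp]: "finite (S\<^sub>0 t)" and finite_S [simp]: "finite (S t)"
  using finite_subset[OF S0_subset] finite_subset[OF S_subset_S0] by auto

lemma S0_low:
  assumes "1 \<le> l" "l \<le> n" "l \<le> t"
  shows "l \<in> S\<^sub>0 t"
  using assms by (auto simp: S\<^sub>0_def cond_iii_def boxes_def)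

lemma S0_n: "S\<^sub>0 n = {1..n}"
  using S0_subset[of n] S0_low[of _ n] by auto

lemma S0_nonrow:
  assumes "Suc t \<notin> R"
  shows "S\<^sub>0 t = S\<^sub>0 (Suc t)"
proof -
  have *: "t < b \<longleftrightarrow> Suc t < b" "b \<le> t \<longleftrightarrow> b \<le> Suc t" if "b \<in> R" for b
    using assms that by (metis Suc_lessI Suc_lessD) (metis assms that le_Suc_eq)
  show ?thesis
    unfolding S\<^sub>0_def cond_ii_def cond_iii_def using * by (auto split: if_splits)
qed

text \<open>Take the first box below row \<open>t\<close> in column \<open>p\<close> that is not an
  unrestricted zero. If it contained a zero, there would be a plus to its left and the plus in
  \<open>(t, p)\<close> above it, against the Le-condition.\<close>

lemma P_subset_S0: "P t \<subseteq> S\<^sub>0 t"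
proof
  fix p assume p: "p \<in> P t"
  have "cond_ii E t p" if "\<not> cond_iii E t p"
  proof -
    let ?Q = "\<lambda>b. b \<in> R \<and> t < b \<and> (b, p) \<in> boxes E \<and> \<not> unrestricted_zero E b p"
    define b where "b = (LEAST b. ?Q b)"
    have "\<exists>b. ?Q b" using that by (auto simp: cond_iii_def)
    hence b: "?Q b" unfolding b_def by (rule LeastI_ex)
    have min: "\<not> ?Q b'" if "b' < b" for b'
      using that unfolding b_def by (rule not_less_Least)
    have "(b, p) \<in> plusses E"
    proof (rule ccontr)
      assume "(b, p) \<notin> plusses E"
      hence z: "(b, p) \<in> zeros E" using b by (simp add: zeros_def)
      then obtain j' where "j' > p" "(b, j') \<in> plusses E"
        using b by (auto simp: unrestricted_zero_def)
      thus False using le_condition[OF z p] b by (auto simp: row_plus_def not_le[symmetric])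
    qed
    moreover have "(b', p) \<in> boxes E" if "b' \<in> R" "b' < b" for b'
      using that b by (auto simp: boxes_def)
    ultimately show ?thesis using b min unfolding cond_ii_def by blast
  qed
  thus "p \<in> S\<^sub>0 t" using P_range[OF p] by (auto simp: S\<^sub>0_def)
qed

text \<open>Passing row \<open>Suc t\<close> removes its own label. A column with a plus there is in
  the new set, a restricted zero removes its column, and an unrestricted zero hands the decision on
  to the rows below.\<close>

lemma S0_row:
  assumes "Suc t \<in> R"
  shows "S\<^sub>0 t = S\<^sub>0 (Suc t) \<inter> {..<Suc t} \<union> P (Suc t) \<union> S\<^sub>0 (Suc t) \<inter> {Max (P (Suc t))<..}"
proof -
  let ?b = "Suc t"
  define m where "m = Max (P ?b)"
  have M: "m \<in> P ?b" unfolding m_def using P_nonempty[OF assms] by simp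
  have Mge: "p \<le> m" if "p \<in> P ?b" for p unfolding m_def using Max_ge[OF _ that] by simp
  have "l \<in> S\<^sub>0 t \<longleftrightarrow> l \<in> S\<^sub>0 ?b \<inter> {..<?b} \<union> P ?b \<union> S\<^sub>0 ?b \<inter> {m<..}" (is "_ \<longleftrightarrow> l \<in> ?S'") for l
  proof -
    consider "l \<notin> {1..n}" | "l \<in> {1..n}" "l < ?b" | "l = ?b" | "l \<in> {1..n}" "?b < l" "l \<in> R"
      | "l \<in> {1..n}" "?b < l" "l \<notin> R" by force
    thus ?thesis
    proof cases
      case 1
      thus ?thesis using S0_subset P_range by fastforce
    next
      case 2
      thus ?thesis using S0_low[of l t] S0_low[of l ?b] by auto
    next
      case 3
      thus ?thesis using assms M by (auto simp: S\<^sub>0_def dest: row_plusD(3))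
    next
      case 4
      thus ?thesis by (auto simp: S\<^sub>0_def dest: P_range)
    next
      case 5
      have box: "(?b, l) \<in> boxes E"
        using 5 assms by (auto simp: boxes_def col_labels_def)
      \<comment> \<open>In this row a zero is unrestricted exactly when it lies to the left of the
        leftmost plus, in column \<open>m\<close>.\<close>
      have u: "unrestricted_zero E ?b l \<longleftrightarrow> m < l"
      proof
        assume "unrestricted_zero E ?b l"
        hence "l \<noteq> m \<and> \<not> l < m" using M
          by (auto simp: unrestricted_zero_def zeros_def row_plus_def)
        thus "m < l" by simp
      next
        assume "m < l"
        thus "unrestricted_zero E ?b l" using box Mge
          by (fastforce simp: unrestricted_zero_def zeros_def row_plus_def)
      qed
      have lt: "t < b \<longleftrightarrow> b = ?b \<or> ?b < b" for b by auto
      have "cond_ii E t l \<longleftrightarrow> l \<in> P ?b \<or> (m < l \<and> cond_ii E ?b l)"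
        unfolding cond_ii_def lt u[symmetric] row_plus_def mem_Collect_eq
        using assms by (smt (verit) less_irrefl less_trans)
      moreover have "cond_iii E t l \<longleftrightarrow> (m < l \<and> cond_iii E ?b l)"
        unfolding cond_iii_def lt u[symmetric] using assms box by blast
      ultimately show ?thesis using 5 by (auto simp: S\<^sub>0_def)
    qed
  qed
  thus ?thesis unfolding m_def by blast
qed

text \<open>Going up past a row only removes labels, since by \<open>P_subset_S0\<close> the columns
  of its plusses already belong to the set.\<close>

lemma S0_mono:
  assumes "t \<le> u"
  shows "S\<^sub>0 t \<subseteq> S\<^sub>0 u"
  using assms
proof (induction u rule: dec_induct)
  case (step u)
  have "S\<^sub>0 u \<subseteq> S\<^sub>0 (Suc u)"
    using S0_row[of u] S0_nonrow[of u] P_subset_S0[of "Suc u"] by (cases "Suc u \<in> R") auto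
  thus ?case using step by blast
qed simp

lemma corner_in: "r \<in> R \<Longrightarrow> corner r \<in> P r"
  using P_nonempty by (simp add: corner_def)

lemma corner_le_a: "r \<in> R \<Longrightarrow> r < a \<Longrightarrow> corner r \<le> a"
  using P_less_a[of r "corner r"] corner_in[of r] by (cases "a \<in> P r") (auto simp: corner_def)

text \<open>Only a row of type (II) has plusses beyond its corner; elsewhere the corner is the
  leftmost plus.\<close>

lemma corner_eq_a:
  assumes "p \<in> P r" "corner r < p"
  shows "corner r = a" "r < a"
proof -
  have "a \<in> P r"
    using assms Max_ge[OF finite_P assms(1)] unfolding corner_def by (metis leD)
  thus "corner r = a" "r < a" using row_plusD(3) by (auto simp: corner_def)
qed

text \<open>These are the hypotheses of \<open>cyc_exchange\<close> for
  \<open>L = corner (Suc t)\<close>, and the form of the next state that it yields.\<close>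

lemma
  assumes "Suc t \<in> R"
  shows S_row: "S t = S (Suc t) \<inter> {..<Suc t} \<union> P (Suc t) \<inter> {..corner (Suc t)}
                  \<union> S (Suc t) \<inter> {corner (Suc t)<..}"
    and P_subset_S: "P (Suc t) \<inter> {..corner (Suc t)} \<subseteq> S (Suc t)"
    and P_disjoint_S: "P (Suc t) \<inter> {corner (Suc t)<..} \<inter> S (Suc t) = {}"
    and Suc_in_S: "Suc t \<in> S (Suc t)"
proof -
  let ?b = "Suc t"
  have ba: "?b \<noteq> a" using assms a_notin_R by auto
  define m where "m = Max (P ?b)"
  have PM: "p \<le> m" if "p \<in> P ?b" for p unfolding m_def using Max_ge[OF _ that] by simp
  have c: "corner ?b = (if a \<in> P ?b then a else m)" by (simp add: corner_def m_def)
  have s: "S\<^sub>0 t = S\<^sub>0 ?b \<inter> {..<?b} \<union> P ?b \<union> S\<^sub>0 ?b \<inter> {m<..}"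
    using S0_row[OF assms] by (simp add: m_def)
  \<comment> \<open>A row below \<open>a\<close> sees no cut. In a row of type (II) above
    \<open>a\<close> the cut is at the corner, and in one of type (I) above \<open>a\<close> all
    plusses lie before the cut.\<close>
  consider "a < ?b" | "?b < a" "a \<in> P ?b" | "?b < a" "a \<notin> P ?b" using ba by force
  thus "S t = S ?b \<inter> {..<?b} \<union> P ?b \<inter> {..corner ?b} \<union> S ?b \<inter> {corner ?b<..}"
  proof cases
    case 1
    hence "corner ?b = m" using row_plusD(3)[of a ?b] by (auto simp: c)
    thus ?thesis using 1 PM by (auto simp: S_def s)
  next
    case 2
    thus ?thesis using PM[of a] by (auto simp: S_def s c)
  next
    case 3
    thus ?thesis using PM less_imp_le[OF P_less_a[OF assms]] by (auto simp: S_def s c)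
  qed
  show "P ?b \<inter> {..corner ?b} \<subseteq> S ?b"
    using P_subset_S0[of ?b] corner_le_a[OF assms] by (auto simp: S_def)
  show "P ?b \<inter> {corner ?b<..} \<inter> S ?b = {}"
    using corner_eq_a by (fastforce simp: S_def)
  show "?b \<in> S ?b"
    using S0_low[of ?b ?b] R_range[OF assms] by (auto simp: S_def)
qed

lemma S_a: "Suc t = a \<Longrightarrow> S t = S a \<inter> {..a}" "a \<in> S a"
  using S0_nonrow[of t] a_notin_R S0_low[of a a] a_range by (auto simp: S_def)

lemma S_other: "Suc t \<notin> R \<Longrightarrow> Suc t \<noteq> a \<Longrightarrow> S t = S (Suc t)"
  using S0_nonrow[of t] by (auto simp: S_def)

text \<open>If \<open>1\<close> is a row, only its rightmost plus survives the cut at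
  \<open>a\<close>; otherwise \<open>a = 1\<close> and the cut leaves only \<open>1\<close>.\<close>

lemma S_0: "S 0 = {a}"
proof (cases "1 \<in> R")
  case True
  have "corner 1 = a" using a_row1[OF True] by (simp add: corner_def)
  moreover have "1 < a" using a_row1(1)[OF True] row_plusD(3) by blast
  ultimately have "S 0 = S\<^sub>0 1 \<inter> {..<1} \<union> P 1 \<inter> {..a}"
    using S_row[of 0] True by (auto simp: S_def)
  also have "\<dots> = {a}" using a_row1[OF True] S0_subset[of 1] by (auto intro: antisym)
  finally show ?thesis .
next
  case False
  have "1 \<in> S\<^sub>0 0" using S0_nonrow[of 0] False S0_low[of 1 1] n_pos by simp
  thus ?thesis using a_no_row1[OF False] S0_subset[of 0] by (auto simp: S_def)
qed

lemma S_n: "S n = {1..n}"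
  using a_range by (simp add: S_def S0_n)


section \<open>The output of the algorithm\<close>

abbreviation D where "D \<equiv> algorithm E"

lemma algorithm_simps [simp]:
  "path_length D = n" "row_labels D = insert a R"
  by (simp_all add: algorithm_def out_rows_def)

sublocale out: plusses_in_boxes D
  using R_range a_range
  by unfold_locales (auto simp: boxes_def col_labels_def, auto simp: algorithm_def out_rows_def)

text \<open>A column label before the next row has no box of \<open>E\<close> in a row below
  \<open>r\<close>, so (iii) holds vacuously. Thus the unconditional plusses of the rule also come
  from membership in \<open>S\<^sub>0 r\<close>.\<close>

lemma type_I_rule_iff:
  assumes r: "r \<in> insert a R" and l: "l \<in> {1..n}" "l \<notin> insert a R" "r < l"
  shows "type_I_rule E r l \<longleftrightarrow> enat l < leftmost_plus E r \<and> l \<in> S\<^sub>0 r"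
proof -
  let ?N = "{i \<in> out_rows E. r < i}"
  have fin: "finite ?N" by (simp add: out_rows_def)
  have nl: "next_row E r \<noteq> l"
    using Min_in[OF fin] l by (auto simp: next_row_def out_rows_def split: if_splits)
  have W: "next_row E r \<le> b" if "b \<in> R" "r < b" for b
    using that Min_le[OF fin, of b] by (auto simp: next_row_def out_rows_def)
  have "cond_iii E r l" if "l < next_row E r"
    unfolding cond_iii_def using W that by (fastforce simp: boxes_def)
  moreover have "cond_ii E r l \<or> cond_iii E r l" if "cond_i E r l"
    using that P_subset_S0[of r] l by (auto simp: cond_i_def row_plus_def S\<^sub>0_def)
  ultimately show ?thesis
    using l nl unfolding type_I_rule_def by (auto simp: S\<^sub>0_def not_less[symmetric])
qed

lemma out_row_plus:
  "row_plus D r = {l \<in> {1..n} - insert a R. r \<in> insert a R \<and> r < l \<and> out_plus E r l}"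
  by (auto simp: row_plus_def algorithm_def out_rows_def)

lemma out_row_a: "row_plus D a = S a \<inter> {a<..}"
  using type_I_rule_iff[of a] S0_subset[of a] a_notin_R
  by (auto simp: out_row_plus out_plus_def type_II_row_def leftmost_plus_def S_def)
     (auto simp: S\<^sub>0_def split: if_splits)

text \<open>The right side is the set of \<open>cyc_exchange\<close> with pivot
  \<open>corner r\<close>. In type (I) its second part is empty; in type (II) this part consists of
  the old plusses beyond \<open>a\<close>.\<close>

lemma out_row_R:
  assumes "r \<in> R"
  shows "row_plus D r = S r \<inter> {r<..<corner r} \<union> P r \<inter> {corner r<..}"
proof -
  have ra: "r \<noteq> a" using assms a_notin_R by auto
  have lm: "leftmost_plus E r = enat (Max (P r))"
    using ra by (simp add: leftmost_plus_def row_plus_def)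
  have II: "type_II_row E r \<longleftrightarrow> a \<in> P r"
    using assms by (simp add: type_II_row_def row_plus_def)
  show ?thesis
  proof (rule set_eqI)
    fix l
    consider "l = a" | "l \<notin> {1..n} \<or> l \<in> R \<or> l \<le> r" | "l \<in> {1..n}" "l \<notin> insert a R" "r < l"
      by force
    thus "l \<in> row_plus D r \<longleftrightarrow> l \<in> S r \<inter> {r<..<corner r} \<union> P r \<inter> {corner r<..}"
    proof cases
      case 1
      \<comment> \<open>The label \<open>a\<close> is now a row label. The right side omits it too:
        \<open>a\<close> cannot lie strictly between \<open>r\<close> and the corner, and if
        \<open>a\<close> is in \<open>P r\<close> it is the corner.\<close>
      thus ?thesis using corner_le_a[OF assms] by (auto simp: out_row_plus corner_def)
    next
      case 2
      have "l \<notin> S r \<inter> {r<..<corner r}"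
        using 2 S_subset_S0[of r] S0_subset[of r] by (auto simp: S\<^sub>0_def)
      moreover have "l \<notin> P r" using 2 P_range row_plusD(3) by fastforce
      ultimately show ?thesis using 2 by (auto simp: out_row_plus)
    next
      case 3
      have rule: "type_I_rule E r l \<longleftrightarrow> l < Max (P r) \<and> l \<in> S\<^sub>0 r"
        using type_I_rule_iff[of r l] 3 assms lm by simp
      show ?thesis
      proof (cases "a \<in> P r")
        case True
        have "r < a" "a \<le> Max (P r)" using True row_plusD(3) Max_ge[OF finite_P] by auto
        moreover from this have "l < a \<Longrightarrow> l < Max (P r)" by simp
        ultimately show ?thesis
          using 3 True II rule assms unfolding out_row_plus out_plus_def
          by (auto simp: corner_def S_def row_plus_def[of E r, symmetric]) (auto simp: row_plus_def)
      next
        case False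
        have "r < a \<Longrightarrow> Max (P r) < a"
          using P_less_a[OF assms] False corner_in[OF assms] by (simp add: corner_def)
        moreover have "l \<notin> P r \<inter> {Max (P r)<..}"
          using leD[OF Max_ge[OF finite_P, of l r]] by blast
        ultimately show ?thesis
          using 3 False II rule assms unfolding out_row_plus out_plus_def
          by (auto simp: corner_def S_def)
      qed
    qed
  qed
qed

lemma out_row_other: "r \<noteq> a \<Longrightarrow> r \<notin> R \<Longrightarrow> row_plus D r = {}"
  by (simp add: out_row_plus)

section \<open>T-duality of the decorated permutations\<close>

lemma row_prod_out: "row_prod D t = row_prod E t \<circ> cyc (S t)"
proof (induction t)
  case 0
  show ?case by (simp add: S_0 cyc_singleton)
next
  case (Suc t)
  let ?b = "Suc t"
  \<comment> \<open>One level of the passage: \<open>cyc_exchange\<close> in an old row,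
    \<open>cyc_split\<close> in row \<open>a\<close>, and the identity on both row cycles
    otherwise.\<close>
  have "cyc (S t) \<circ> cyc (insert ?b (row_plus D ?b)) = cyc (insert ?b (P ?b)) \<circ> cyc (S ?b)"
  proof (cases "?b \<in> R")
    case True
    show ?thesis
      unfolding S_row[OF True] out_row_R[OF True]
      by (rule cyc_exchange)
         (use corner_in[OF True] Suc_in_S[OF True] P_subset_S[OF True] P_disjoint_S[OF True]
           row_plusD(3) in auto)
  next
    case False
    hence P: "P ?b = {}" by (rule row_plus_nonrow)
    show ?thesis
    proof (cases "?b = a")
      case True
      show ?thesis
        using cyc_split[OF S_a(2)] P unfolding S_a(1)[OF True] True out_row_a
        by (simp add: cyc_singleton)
    next
      case ne: False
      show ?thesis using False ne P by (simp add: S_other out_row_other cyc_singleton)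
    qed
  qed
  thus ?case using Suc by (simp add: fun_eq_iff)
qed

lemma pipe_perm_out: "pipe_perm D = T_dual_perm n (pipe_perm E)"
proof
  fix i
  \<comment> \<open>By \<open>S_n\<close> the cycle composed with all the rows is this shift, the
    one in the definition of the T-dual.\<close>
  have "cyc {1..n} i = (if 1 \<le> i \<and> i < n then i + 1 else if i = n then 1 else i)"
  proof -
    consider "1 \<le> i" "i < n" | "i = n" | "i \<notin> {1..n}" by force
    thus ?thesis
    proof cases
      case 1
      hence "cyc {1..n} i = i + 1" by (intro cyc_next) auto
      thus ?thesis using 1 by simp
    next
      case 2
      hence "cyc {1..n} i = 1" using n_pos by (intro cyc_last) auto
      thus ?thesis using 2 by simp
    next
      case 3
      thus ?thesis using n_pos by (auto simp: cyc_notin)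
    qed
  qed
  moreover have "row_prod E n i = i" if "i \<notin> {1..n}"
    using row_prod_outside[of i n] that by simp
  ultimately show "pipe_perm D i = T_dual_perm n (pipe_perm E) i"
    by (auto simp: out.pipe_perm_eq pipe_perm_eq row_prod_out S_n T_dual_perm_def)
qed

text \<open>For \<open>i < n\<close> a fixed point means that the old permutation sends
  \<open>i + 1\<close> down to \<open>i\<close>, which by \<open>row_prod_ge\<close> makes
  \<open>i\<close> an old row label. For \<open>i = n\<close> it means \<open>n = a\<close>.\<close>

lemma fixed_point_out:
  assumes "i \<in> {1..n}" "pipe_perm D i = i"
  shows "i \<in> insert a R"
proof (rule ccontr)
  assume i: "i \<notin> insert a R"
  show False
  proof (cases "i < n")
    case True
    hence "row_prod E n (i + 1) = i"
      using assms by (simp add: pipe_perm_out T_dual_perm_def pipe_perm_eq)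
    thus False using row_prod_ge[of n "i + 1"] i by simp
  next
    case False
    hence "pipe_perm E 1 = i" using assms by (simp add: pipe_perm_out T_dual_perm_def)
    thus False using i by (simp add: new_row_def dec_perm_def)
  qed
qed

lemma dec_perm_out: "dec_perm D = T_dual n (dec_perm E)"
proof -
  have "{i \<in> insert a R. pipe_perm D i = i} = {i \<in> {1..n}. pipe_perm D i = i}"
    using fixed_point_out R_range a_range by auto
  moreover have "{i \<in> col_labels D. pipe_perm D i = i} = {}"
    using fixed_point_out by (auto simp: col_labels_def)
  ultimately show ?thesis
    by (simp add: dec_perm_def T_dual_def pipe_perm_out)
qed

section \<open>The Le-condition for the new filling\<close>

lemma le_diagram_out: "le_diagram (k + 1) n D"
proof -
  have "\<not> ((\<exists>i'<i. (i', j) \<in> plusses D) \<and> (\<exists>j'>j. (i, j') \<in> plusses D))"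
    if z: "(i, j) \<in> zeros D" for i j
  proof safe
    fix i' j'
    assume i': "i' < i" and "(i', j) \<in> plusses D" and j': "j < j'" and "(i, j') \<in> plusses D"
    hence p: "j \<in> row_plus D i'" "j' \<in> row_plus D i" by (simp_all add: row_plus_def)
    have box: "i \<in> insert a R" "1 \<le> j" "j \<le> n" "j \<noteq> a" "j \<notin> R" "i < j" and nj: "j \<notin> row_plus D i"
      using z by (auto simp: zeros_def boxes_def col_labels_def row_plus_def)
    have i'R: "i' = a \<or> i' \<in> R" using p(1) out_row_other by blast
    \<comment> \<open>The plus in row \<open>i'\<close> puts \<open>j\<close> into the state there
      and so, by monotonicity, into that of the lower row \<open>i\<close>. Before the corner, or in
      row \<open>a\<close>, this forces a plus in box \<open>(i, j)\<close>.\<close>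
    have "j \<in> S\<^sub>0 i'"
      using i'R p(1) S_subset_S0[of i'] P_subset_S0[of i'] by (auto simp: out_row_a out_row_R)
    hence jS: "j \<in> S\<^sub>0 i" using S0_mono[of i' i] i' by auto
    show False
    proof (cases "i = a")
      case True
      thus False using jS nj box by (simp add: out_row_a S_def)
    next
      case False
      hence iR: "i \<in> R" using box by simp
      consider "j < corner i" | "corner i \<le> j" by linarith
      thus False
      proof cases
        case 1
        hence "i < a \<Longrightarrow> j \<le> a" using corner_le_a[OF iR] by simp
        thus False using 1 jS nj box by (auto simp: out_row_R[OF iR] S_def split: if_splits)
      next
        case 2
        \<comment> \<open>From the corner on, row \<open>i\<close> has only old plusses. So it is of
          type (II), and the Le-condition of \<open>E\<close> can be used.\<close>
        hence j'P: "j' \<in> P i" "corner i < j'" using p(2) j' by (auto simp: out_row_R[OF iR])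
        hence c: "corner i = a" "i < a" by (auto dest: corner_eq_a)
        hence aj: "a < j" using 2 box by simp
        hence "j \<notin> P i" using nj c by (simp add: out_row_R[OF iR])
        hence "(i, j) \<in> zeros E"
          using iR box by (simp add: zeros_def boxes_def col_labels_def row_plus_def)
        \<comment> \<open>Row \<open>i'\<close> lies above \<open>a\<close>, where the state stops
          at \<open>a\<close>; its plus in column \<open>j > a\<close> is therefore an old
          one.\<close>
        moreover have "j \<in> P i'"
          using i'R p(1) i' c aj by (auto simp: out_row_R S_def)
        ultimately show False using le_condition j'P i' j' by fastforce
      qed
    qed
  qed
  moreover have "card (insert a R) = k + 1"
    using le_E a_notin_R by (simp add: le_diagram_def)
  ultimately show ?thesis
    using out.rows out.plus_boxes by (auto simp: le_diagram_def)
qed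

section \<open>Counting the plusses\<close>

lemma card_row_out:
  "card (row_plus D (Suc t)) + card (S t) + (if Suc t \<in> R then 2 else 0)
     = card (P (Suc t)) + card (S (Suc t))"
proof -
  let ?b = "Suc t"
  show ?thesis
  proof (cases "?b \<in> R")
    case True
    show ?thesis
      unfolding S_row[OF True] out_row_R[OF True]
      using card_exchange[of "S ?b" "P ?b" ?b "corner ?b"] True corner_in[OF True]
        Suc_in_S[OF True] P_subset_S[OF True] row_plusD(3) by simp
  next
    case False
    hence P: "P ?b = {}" by (rule row_plus_nonrow)
    show ?thesis
    proof (cases "?b = a")
      case True
      have "S a = S a \<inter> {..a} \<union> S a \<inter> {a<..}" by auto
      hence "card (S a) = card (S a \<inter> {..a} \<union> S a \<inter> {a<..})" by simp
      also have "\<dots> = card (S a \<inter> {..a}) + card (S a \<inter> {a<..})"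
        by (intro card_Un_disjoint) auto
      finally show ?thesis
        using False P unfolding S_a(1)[OF True] True out_row_a by simp
    next
      case ne: False
      show ?thesis using False ne P by (simp add: S_other out_row_other)
    qed
  qed
qed

text \<open>The row equations telescope; the \<open>1\<close> is the cardinality of
  \<open>S 0\<close>. At \<open>t = n\<close> the last term is \<open>n\<close>.\<close>

lemma sum_card_rows_out:
  "(\<Sum>r=1..t. card (row_plus D r)) + 1 + 2 * card (R \<inter> {..t})
     = (\<Sum>r=1..t. card (P r)) + card (S t)"
proof (induction t)
  case 0
  have "R \<inter> {..0} = {}" using R_range by fastforce
  thus ?case by (simp add: S_0)
next
  case (Suc t)
  have "card (R \<inter> {..Suc t}) = card (R \<inter> {..t}) + (if Suc t \<in> R then 1 else 0)"
    by (simp add: atMost_Suc Int_insert_right)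
  thus ?case using Suc card_row_out[of t] by (simp split: if_splits)
qed

end

lemma (in plusses_in_boxes) card_plusses:
  "card (plusses D) = (\<Sum>r=1..path_length D. card (row_plus D r))"
proof -
  have "plusses D = Sigma {1..path_length D} (row_plus D)"
    using plus_boxes rows by (auto simp: row_plus_def boxes_def)
  moreover have "finite (row_plus D r)" for r
    by (rule finite_subset[of _ "{1..path_length D}"])
       (auto dest: row_plusD(2) simp: col_labels_def)
  ultimately show ?thesis by simp
qed

theorem mainTheorem8:
  fixes k n :: nat and Dhat D :: filling
  assumes "n \<ge> 1"
    and "le_diagram k n Dhat"
    and "coloopless Dhat"
    and "D = algorithm Dhat"
  shows "le_diagram (k + 1) n D \<and> loopless D \<and>
         int (card (plusses D)) = int (card (plusses Dhat)) - 2 * int k + (int n - 1) \<and>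
         dec_perm D = T_dual n (dec_perm Dhat)"
proof -
  interpret E: coloopless_le_diagram k n Dhat
    using assms by unfold_locales
  have "E.R \<inter> {..n} = E.R" using E.R_range by auto
  moreover have "card E.R = k" using assms by (simp add: le_diagram_def)
  ultimately have "card (plusses D) + 1 + 2 * k = card (plusses Dhat) + n"
    using E.sum_card_rows_out[of n] assms(4)
    by (simp add: E.card_plusses E.out.card_plusses E.S_n)
  hence "int (card (plusses D)) = int (card (plusses Dhat)) - 2 * int k + (int n - 1)"
    by linarith
  moreover have "loopless D"
    using E.dec_perm_out assms(4) by (simp add: loopless_def T_dual_def)
  ultimately show ?thesis
    using E.le_diagram_out E.dec_perm_out assms(4) by simp
qed

end
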